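(* Let $\sigma=\{R\}$ with $R$ binary, and let $\Phi=\mathsf{Split}\vee\mathsf{Diverse}$ be the sentence defined in the context. Then $\Phi$ belongs to $\mathsf{FL}[0](\sigma)$, has quantifier rank three, and is preserved under extensions (if $\mathfrak C\subseteq\mathfrak D$ are $\sigma$-structures and $\mathfrak C\models\Phi$, then $\mathfrak D\models\Phi$), but there is no existential fluted sentence $\psi\in\exists\mathsf{FL}[0](\sigma)$ equivalent to $\Phi$ over all $\sigma$-structures. Consequently, the fragment-internal Łoś–Tarski theorem (``every fluted sentence preserved under extensions is equivalent to an existential fluted sentence'') fails already for the signature $\sigma=\{R\}$ consisting of a single binary relation symbol.
   Context: All structures have non-empty domains; there is no equality in the language. $\mathfrak C\subseteq\mathfrak D$ means that $\mathfrak C$ is the induced substructure of $\mathfrak D$ on $C\subseteq D$; then $\mathfrak D$ is an extension of $\mathfrak C$. Fluted fragment. Fix variables $x_1,x_2,\ldots$. For a finite signature $\sigma$ of relation symbols of positive arity, the levels $\mathsf{FL}[m](\sigma)$, $m\ge 0$, are defined by simultaneous induction: $\top,\bot\in\mathsf{FL}[m](\sigma)$; if $R\in\sigma$ has arity $r\le m$, then the suffix atom $R(x_{m-r+1},\ldots,x_m)$ is in $\mathsf{FL}[m](\sigma)$; $\mathsf{FL}[m](\sigma)$ is closed under $\neg,\wedge,\vee$; if $\varphi\in\mathsf{FL}[m+1](\sigma)$, then $\exists x_{m+1}\varphi,\forall x_{m+1}\varphi\in\mathsf{FL}[m](\sigma)$. $\mathsf{FL}[0](\sigma)$ is the set of fluted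 sentences. Quantifier rank is the usual one. The existential levels $\exists\mathsf{FL}[m](\sigma)$ are generated from permitted suffix atoms, negated suffix atoms and truth constants by $\wedge$, $\vee$ and existential quantification (if $\varphi\in\exists\mathsf{FL}[m+1](\sigma)$ then $\exists x_{m+1}\varphi\in\exists\mathsf{FL}[m](\sigma)$); no universal quantifiers. The sentence $\Phi$. Let $\mathsf Z(x_2):=\forall x_3\,\neg R(x_2,x_3)$, $\mathsf O(x_2):=\forall x_3\,R(x_2,x_3)$, $\mathsf M(x_2):=\exists x_3 R(x_2,x_3)\wedge\exists x_3\neg R(x_2,x_3)$, and $\mathsf M(x_1):=\exists x_2R(x_1,x_2)\wedge\exists x_2\neg R(x_1,x_2)$. For $\varepsilon\in\{0,1\}$ let $R^{1}(x_1,x_2):=R(x_1,x_2)$, $R^{0}(x_1,x_2):=\neg R(x_1,x_2)$, and for $T\in\{\mathsf Z,\mathsf O,\mathsf M\}$ let $E_{\varepsilon,T}(x_1):=\exists x_2(R^{\varepsilon}(x_1,x_2)\wedge T(x_2))$. Put $$\mathsf{Split}:=\bigvee_{T\in\{\mathsf Z,\mathsf O,\mathsf M\}}\exists x_1(E_{0,T}(x_1)\wedge E_{1,T}(x_1)),$$ $$\mathsf{Diverse}:=\bigvee_{\varepsilon\in\{0,1\},\,T\in\{\mathsf Z,\mathsf O,\mathsf M\}}\bigl[\exists x_1(\mathsf M(x_1)\wedge E_{\varepsilon,T}(x_1))\wedge\exists x_1(\mathsf M(x_1)\wedge\neg E_{\varepsilon,T}(x_1))\bigr],$$ $$\Phi:=\mathsf{Split}\vee\mathsf{Diverse}.$$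 *)

theory Defs
  imports Main
begin

text \<open>
  A signature maps each of its relation symbols to its arity.  The number \<open>i\<close> stands for
  the variable \<open>x\<^sub>i\<close>, with indices starting at \<open>1\<close> (the index \<open>0\<close> is never used by fluted formulas).
  There is no equality in the language.
\<close>

type_synonym 's signature = "'s \<rightharpoonup> nat"

definition is_signature :: "'s signature \<Rightarrow> bool" where
  "is_signature \<sigma> \<longleftrightarrow> finite (dom \<sigma>) \<and> (\<forall>r \<in> ran \<sigma>. 0 < r)"

datatype 's fm =
    Tru
  | Fls
  | Atom 's "nat list"
  | Neg "'s fm"
  | Conj "'s fm" "'s fm"
  | Disj "'s fm" "'s fm"
  | Exists nat "'s fm"
  | Forall nat "'s fm"

fun qrank :: "'s fm \<Rightarrow> nat" where
  "qrank Tru = 0"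
| "qrank Fls = 0"
| "qrank (Atom S xs) = 0"
| "qrank (Neg \<phi>) = qrank \<phi>"
| "qrank (Conj \<phi> \<psi>) = max (qrank \<phi>) (qrank \<psi>)"
| "qrank (Disj \<phi> \<psi>) = max (qrank \<phi>) (qrank \<psi>)"
| "qrank (Exists x \<phi>) = Suc (qrank \<phi>)"
| "qrank (Forall x \<phi>) = Suc (qrank \<phi>)"

text \<open>The variable list \<open>x\<^bsub>m-r+1\<^esub>, \<dots>, x\<^sub>m\<close>, used only for \<open>r \<le> m\<close>.\<close>

definition suffix_vars :: "nat \<Rightarrow> nat \<Rightarrow> nat list" where
  "suffix_vars m r = [m - r + 1..<m + 1]"

inductive FL :: "'s signature \<Rightarrow> nat \<Rightarrow> 's fm \<Rightarrow> bool" for \<sigma> where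
  FL_Tru: "FL \<sigma> m Tru"
| FL_Fls: "FL \<sigma> m Fls"
| FL_Atom: "\<sigma> S = Some r \<Longrightarrow> r \<le> m \<Longrightarrow> FL \<sigma> m (Atom S (suffix_vars m r))"
| FL_Neg: "FL \<sigma> m \<phi> \<Longrightarrow> FL \<sigma> m (Neg \<phi>)"
| FL_Conj: "FL \<sigma> m \<phi> \<Longrightarrow> FL \<sigma> m \<psi> \<Longrightarrow> FL \<sigma> m (Conj \<phi> \<psi>)"
| FL_Disj: "FL \<sigma> m \<phi> \<Longrightarrow> FL \<sigma> m \<psi> \<Longrightarrow> FL \<sigma> m (Disj \<phi> \<psi>)"
| FL_Exists: "FL \<sigma> (m + 1) \<phi> \<Longrightarrow> FL \<sigma> m (Exists (m + 1) \<phi>)"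
| FL_Forall: "FL \<sigma> (m + 1) \<phi> \<Longrightarrow> FL \<sigma> m (Forall (m + 1) \<phi>)"

inductive EFL :: "'s signature \<Rightarrow> nat \<Rightarrow> 's fm \<Rightarrow> bool" for \<sigma> where
  EFL_Tru: "EFL \<sigma> m Tru"
| EFL_Fls: "EFL \<sigma> m Fls"
| EFL_Atom: "\<sigma> S = Some r \<Longrightarrow> r \<le> m \<Longrightarrow> EFL \<sigma> m (Atom S (suffix_vars m r))"
| EFL_NegAtom: "\<sigma> S = Some r \<Longrightarrow> r \<le> m \<Longrightarrow> EFL \<sigma> m (Neg (Atom S (suffix_vars m r)))"
| EFL_Conj: "EFL \<sigma> m \<phi> \<Longrightarrow> EFL \<sigma> m \<psi> \<Longrightarrow> EFL \<sigma> m (Conj \<phi> \<psi>)"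
| EFL_Disj: "EFL \<sigma> m \<phi> \<Longrightarrow> EFL \<sigma> m \<psi> \<Longrightarrow> EFL \<sigma> m (Disj \<phi> \<psi>)"
| EFL_Exists: "EFL \<sigma> (m + 1) \<phi> \<Longrightarrow> EFL \<sigma> m (Exists (m + 1) \<phi>)"

text \<open>
  The domain of a structure is a set of elements of the type \<open>'a\<close>, not the whole type.
  The interpretation of symbols outside the signature is irrelevant and left unconstrained.
\<close>

record ('s, 'a) struct =
  domain :: "'a set"
  rel :: "'s \<Rightarrow> 'a list set"

definition is_struct :: "'s signature \<Rightarrow> ('s, 'a) struct \<Rightarrow> bool" where
  "is_struct \<sigma> A \<longleftrightarrow> domain A \<noteq> {} \<and>
     (\<forall>S r. \<sigma> S = Some r \<longrightarrow> rel A S \<subseteq> {as. length as = r \<and> set as \<subseteq> domain A})"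

definition substructure :: "'s signature \<Rightarrow> ('s, 'a) struct \<Rightarrow> ('s, 'a) struct \<Rightarrow> bool" where
  "substructure \<sigma> C D \<longleftrightarrow> domain C \<subseteq> domain D \<and>
     (\<forall>S \<in> dom \<sigma>. rel C S = {as \<in> rel D S. set as \<subseteq> domain C})"

fun sat :: "('s, 'a) struct \<Rightarrow> (nat \<Rightarrow> 'a) \<Rightarrow> 's fm \<Rightarrow> bool" where
  "sat A v Tru = True"
| "sat A v Fls = False"
| "sat A v (Atom S xs) = (map v xs \<in> rel A S)"
| "sat A v (Neg \<phi>) = (\<not> sat A v \<phi>)"
| "sat A v (Conj \<phi> \<psi>) = (sat A v \<phi> \<and> sat A v \<psi>)"
| "sat A v (Disj \<phi> \<psi>) = (sat A v \<phi> \<or> sat A v \<psi>)"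
| "sat A v (Exists x \<phi>) = (\<exists>a \<in> domain A. sat A (v(x := a)) \<phi>)"
| "sat A v (Forall x \<phi>) = (\<forall>a \<in> domain A. sat A (v(x := a)) \<phi>)"

definition models :: "('s, 'a) struct \<Rightarrow> 's fm \<Rightarrow> bool" where
  "models A \<phi> \<longleftrightarrow> (\<forall>v. range v \<subseteq> domain A \<longrightarrow> sat A v \<phi>)"

text \<open>
  HOL cannot quantify over types inside a formula, so the following notions range over all
  structures whose domain is a subset of the type \<open>'a\<close>, which is passed as an argument.
\<close>

definition preserved_ext :: "'a itself \<Rightarrow> 's signature \<Rightarrow> 's fm \<Rightarrow> bool" where
  "preserved_ext _ \<sigma> \<phi> \<longleftrightarrow>
     (\<forall>C D :: ('s, 'a) struct. is_struct \<sigma> C \<longrightarrow> is_struct \<sigma> D \<longrightarrow> substructure \<sigma> C D \<longrightarrow>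
        models C \<phi> \<longrightarrow> models D \<phi>)"

definition equivalent :: "'a itself \<Rightarrow> 's signature \<Rightarrow> 's fm \<Rightarrow> 's fm \<Rightarrow> bool" where
  "equivalent _ \<sigma> \<phi> \<psi> \<longleftrightarrow>
     (\<forall>A :: ('s, 'a) struct. is_struct \<sigma> A \<longrightarrow> (models A \<phi> \<longleftrightarrow> models A \<psi>))"

definition fluted_Los_Tarski :: "'a itself \<Rightarrow> 's signature \<Rightarrow> bool" where
  "fluted_Los_Tarski T \<sigma> \<longleftrightarrow>
     (\<forall>\<phi>. FL \<sigma> 0 \<phi> \<longrightarrow> preserved_ext T \<sigma> \<phi> \<longrightarrow> (\<exists>\<psi>. EFL \<sigma> 0 \<psi> \<and> equivalent T \<sigma> \<phi> \<psi>))"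

fun Disjs :: "'s fm list \<Rightarrow> 's fm" where
  "Disjs [] = Fls"
| "Disjs [\<phi>] = \<phi>"
| "Disjs (\<phi> # \<psi> # \<chi>s) = Disj \<phi> (Disjs (\<psi> # \<chi>s))"

context
  fixes R :: 's
begin

definition sig_R :: "'s signature" where
  "sig_R = [R \<mapsto> 2]"

lemma is_signature_sig_R: "is_signature sig_R"
  by (simp add: is_signature_def sig_R_def)

text \<open>The index \<open>i\<close> is that of the free variable \<open>x\<^sub>i\<close>.\<close>

definition Z_fm :: "nat \<Rightarrow> 's fm" where
  "Z_fm i = Forall (i + 1) (Neg (Atom R [i, i + 1]))"

definition O_fm :: "nat \<Rightarrow> 's fm" where
  "O_fm i = Forall (i + 1) (Atom R [i, i + 1])"

definition M_fm :: "nat \<Rightarrow> 's fm" where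
  "M_fm i = Conj (Exists (i + 1) (Atom R [i, i + 1])) (Exists (i + 1) (Neg (Atom R [i, i + 1])))"

definition R_lit :: "bool \<Rightarrow> 's fm" where
  "R_lit \<epsilon> = (if \<epsilon> then Atom R [1, 2] else Neg (Atom R [1, 2]))"

text \<open>Here \<open>T\<close> is the formula \<open>T(x\<^sub>2)\<close>, so that \<open>x\<^sub>1\<close> is the only free variable.\<close>

definition E_fm :: "bool \<Rightarrow> 's fm \<Rightarrow> 's fm" where
  "E_fm \<epsilon> T = Exists 2 (Conj (R_lit \<epsilon>) T)"

definition types_x2 :: "'s fm list" where
  "types_x2 = [Z_fm 2, O_fm 2, M_fm 2]"

definition Split :: "'s fm" where
  "Split = Disjs [Exists 1 (Conj (E_fm False T) (E_fm True T)). T \<leftarrow> types_x2]"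

definition Diverse :: "'s fm" where
  "Diverse = Disjs
     [Conj (Exists 1 (Conj (M_fm 1) (E_fm \<epsilon> T))) (Exists 1 (Conj (M_fm 1) (Neg (E_fm \<epsilon> T)))).
        \<epsilon> \<leftarrow> [False, True], T \<leftarrow> types_x2]"

definition Phi :: "'s fm" where
  "Phi = Disj Split Diverse"

end

end

theory Submission
  imports Defs
begin

text \<open>
  For a relation \<open>r\<close> on \<open>U\<close>, the types \<open>Z\<close>, \<open>O\<close>, \<open>M\<close> of an element \<open>a\<close> correspond to the
  three possible values \<open>{False}\<close>, \<open>{True}\<close>, \<open>{False, True}\<close> of \<open>r a ` U\<close>.  The sentence \<open>\<Phi>\<close>
  fails exactly if elements of the same type have the same rows and the same columns.  This
  condition is inherited by substructures: a mixed element either stays mixed or, as all mixed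
  elements have the same row, no element of the substructure is mixed any more.

  An existential fluted formula only sees the colour (edge or non-edge) of the step from the
  previous to the current element, so it is preserved along relations matching each step by one of
  the same colour.  On \<open>{m, p}\<close> let \<open>p\<close> have edges to everything and \<open>m\<close> an edge to itself only;
  there \<open>\<Phi>\<close> fails.  Adding a second full element \<open>q\<close> with an edge from \<open>m\<close> splits the
  type \<open>O\<close> and makes \<open>\<Phi>\<close> true, but the new step from \<open>m\<close> to \<open>q\<close> can be matched by the loop at \<open>m\<close>.
\<close>

section \<open>The semantics of \<open>\<Phi>\<close>\<close>

definition uniform :: "'a set \<Rightarrow> ('a \<Rightarrow> 'a \<Rightarrow> bool) \<Rightarrow> bool" where
  "uniform U r \<longleftrightarrow>
     (\<forall>b \<in> U. \<forall>c \<in> U. r b ` U = r c ` U \<longrightarrow> (\<forall>a \<in> U. r a b = r a c \<and> r b a = r c a))"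

section \<open>Row images as types\<close>

lemma bool_image_cases:
  assumes "U \<noteq> {}"
  obtains "f ` U = {False}" | "f ` U = {True}" | "f ` U = {False, True}"
proof -
  have "f ` U \<subseteq> {False, True}" "f ` U \<noteq> {}"
    using assms by auto
  then have "f ` U = {False} \<or> f ` U = {True} \<or> f ` U = {False, True}"
    by blast
  then show ?thesis
    using that by blast
qed

lemma bool_image_eq_iff:
  fixes f :: "'a \<Rightarrow> bool"
  assumes "U \<noteq> {}"
  shows "f ` U = {False} \<longleftrightarrow> (\<forall>y \<in> U. \<not> f y)"
    and "f ` U = {True} \<longleftrightarrow> (\<forall>y \<in> U. f y)"
    and "f ` U = {False, True} \<longleftrightarrow> (\<exists>y \<in> U. f y) \<and> (\<exists>y \<in> U. \<not> f y)"
proof -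
  obtain u where "u \<in> U"
    using assms by blast
  then show "f ` U = {False} \<longleftrightarrow> (\<forall>y \<in> U. \<not> f y)"
    and "f ` U = {True} \<longleftrightarrow> (\<forall>y \<in> U. f y)"
    and "f ` U = {False, True} \<longleftrightarrow> (\<exists>y \<in> U. f y) \<and> (\<exists>y \<in> U. \<not> f y)"
    unfolding set_eq_iff all_bool_eq image_iff by simp_all blast+
qed

lemma bool_image_constant:
  assumes "f ` U \<noteq> {False, True}" "f ` U = g ` U" "y \<in> U" "z \<in> U"
  shows "f y = g z"
proof -
  obtain x where x: "x \<in> U" "g z = f x"
    using assms(2,4) by (metis imageE imageI)
  have "f x = f y"
    using bool_image_eq_iff(3)[of U f] assms(1,3) x(1) by blast
  then show ?thesis
    using x by simp
qed

section \<open>Uniformity under restriction\<close>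

lemma uniform_subset:
  assumes U: "uniform U r" and V: "V \<subseteq> U" "V \<noteq> {}"
  shows "uniform V r"
  unfolding uniform_def
proof (intro ballI impI)
  fix b c a
  assume bc: "b \<in> V" "c \<in> V" and eq: "r b ` V = r c ` V" and a: "a \<in> V"
  have U': "r x y = r x z \<and> r y x = r z x"
    if "y \<in> U" "z \<in> U" "r y ` U = r z ` U" "x \<in> U" for x y z
    using U that unfolding uniform_def by blast
  have mixed: "r x ` U = {False, True}" if "r x ` V = {False, True}" for x
  proof -
    have "U \<noteq> {}" "(\<exists>y \<in> V. r x y) \<and> (\<exists>y \<in> V. \<not> r x y)"
      using that V bool_image_eq_iff(3)[OF V(2), of "r x"] by simp_all blast
    then show ?thesis
      unfolding bool_image_eq_iff(3)[OF \<open>U \<noteq> {}\<close>] using V(1) by blast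
  qed
  show "r a b = r a c \<and> r b a = r c a"
  proof (cases "r b ` U = r c ` U")
    case True
    then show ?thesis
      using U'[of b c a] bc a V(1) by blast
  next
    case False
    \<comment> \<open>If \<open>r b\<close> were mixed on \<open>V\<close>, then by
      \<open>eq\<close> so would be \<open>r c\<close>; both would be mixed on \<open>U\<close>,
      contrary to \<open>False\<close>.\<close>
    have const: "r b ` V \<noteq> {False, True}"
      using False eq mixed by metis
    have row: "r b y = r c y" if "y \<in> V" for y
      using bool_image_constant[OF const eq that that] .
    have "U \<noteq> {}"
      using V by auto
    \<comment> \<open>A row constant on \<open>U\<close> has the same image on the nonempty
      \<open>V\<close>, so two such rows with equal images on \<open>V\<close> have equal images on
      \<open>U\<close>.\<close>
    have "r b ` U = {False, True} \<or> r c ` U = {False, True}"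
    proof (rule ccontr)
      assume not_mixed: "\<not> ?thesis"
      have "r x ` V = r x ` U" if "r x ` U \<noteq> {False, True}" for x
        using bool_image_cases[OF \<open>U \<noteq> {}\<close>, of "r x"] image_mono[OF V(1), of "r x"] that V(2)
        by (metis image_is_empty subset_singletonD)
      then show False
        using not_mixed False eq by metis
    qed
    then obtain d where d: "d \<in> {b, c}" "r d ` U = {False, True}"
      by auto
    \<comment> \<open>If \<open>a\<close> were mixed on \<open>V\<close>, hence on \<open>U\<close>,
      it would share the row of \<open>d\<close>, which is constant on \<open>V\<close>.\<close>
    have "r a ` V \<noteq> {False, True}"
    proof
      assume *: "r a ` V = {False, True}"
      have "r a ` V = r d ` V"
      proof (rule image_cong)
        show "r a y = r d y" if "y \<in> V" for y
          using U'[of a d y] d mixed[OF *] that a bc V(1) by blast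
      qed simp
      then show False
        using * const eq d(1) by (metis insertE singletonD)
    qed
    then have "r a b = r a c"
      using bool_image_constant[OF _ refl bc] by blast
    then show ?thesis
      using row a by simp
  qed
qed

section \<open>Truth conditions of \<open>Split\<close>, \<open>Diverse\<close> and
  \<open>Phi\<close>\<close>

lemma sat_Split:
  fixes A :: "('s, 'a) struct" and R :: 's
  assumes "domain A \<noteq> {}"
  defines "r \<equiv> \<lambda>x y. [x, y] \<in> rel A R"
  shows "sat A v (Split R) \<longleftrightarrow>
    (\<exists>a \<in> domain A. \<exists>b \<in> domain A. \<exists>c \<in> domain A.
       r b ` domain A = r c ` domain A \<and> \<not> r a b \<and> r a c)"
proof -
  have "sat A v (Split R) \<longleftrightarrow>
    (\<exists>T \<in> {{False}, {True}, {False, True}}. \<exists>a \<in> domain A.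
      (\<exists>b \<in> domain A. \<not> r a b \<and> r b ` domain A = T) \<and>
      (\<exists>b \<in> domain A. r a b \<and> r b ` domain A = T))"
    by (simp add: Split_def types_x2_def E_fm_def R_lit_def Z_fm_def O_fm_def M_fm_def
        bool_image_eq_iff[OF assms(1)] r_def)
  also have "\<dots> \<longleftrightarrow> (\<exists>a \<in> domain A. \<exists>b \<in> domain A. \<exists>c \<in> domain A.
       r b ` domain A = r c ` domain A \<and> \<not> r a b \<and> r a c)"
  proof -
    have "r b ` domain A \<in> {{False}, {True}, {False, True}}" for b
      using bool_image_cases[OF assms(1), of "r b"] by blast
    then show ?thesis by metis
  qed
  finally show ?thesis .
qed

text \<open>Eliminates the indices of \<open>Diverse\<close>: a witness \<open>b\<close> determines
  them as \<open>e = r a b\<close> and \<open>T = t b\<close>.\<close>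

lemma ex_value_and_type_iff:
  fixes t :: "'a \<Rightarrow> 'c" and r :: "'a \<Rightarrow> 'a \<Rightarrow> bool"
  assumes "\<And>b. t b \<in> K"
  shows "(\<exists>e. \<exists>T \<in> K.
      (\<exists>a \<in> U. t a = M \<and> (\<exists>b \<in> U. r a b = e \<and> t b = T)) \<and>
      (\<exists>a \<in> U. t a = M \<and> \<not> (\<exists>b \<in> U. r a b = e \<and> t b = T))) \<longleftrightarrow>
    (\<exists>a \<in> U. \<exists>a' \<in> U. t a = M \<and> t a' = M \<and>
       (\<exists>b \<in> U. \<forall>c \<in> U. t c = t b \<longrightarrow> r a' c \<noteq> r a b))" (is "?L \<longleftrightarrow> ?R")
proof
  assume ?L
  then show ?R by metis
next
  assume ?R
  then obtain a a' b where "a \<in> U" "a' \<in> U" "b \<in> U" "t a = M" "t a' = M"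
    "\<forall>c \<in> U. t c = t b \<longrightarrow> r a' c \<noteq> r a b"
    by blast
  then show ?L
    using assms by (intro exI[of _ "r a b"] bexI[of _ "t b"]) auto
qed

lemma sat_Diverse:
  fixes A :: "('s, 'a) struct" and R :: 's
  assumes "domain A \<noteq> {}"
  defines "r \<equiv> \<lambda>x y. [x, y] \<in> rel A R"
  shows "sat A v (Diverse R) \<longleftrightarrow>
    (\<exists>a \<in> domain A. \<exists>a' \<in> domain A.
       r a ` domain A = {False, True} \<and> r a' ` domain A = {False, True} \<and>
       (\<exists>b \<in> domain A. \<forall>c \<in> domain A. r c ` domain A = r b ` domain A \<longrightarrow> r a' c \<noteq> r a b))"
proof -
  have "sat A v (Diverse R) \<longleftrightarrow>
    (\<exists>e. \<exists>T \<in> {{False}, {True}, {False, True}}.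
      (\<exists>a \<in> domain A. r a ` domain A = {False, True} \<and>
         (\<exists>b \<in> domain A. r a b = e \<and> r b ` domain A = T)) \<and>
      (\<exists>a \<in> domain A. r a ` domain A = {False, True} \<and>
         \<not> (\<exists>b \<in> domain A. r a b = e \<and> r b ` domain A = T)))"
    by (simp add: Diverse_def types_x2_def E_fm_def R_lit_def Z_fm_def O_fm_def M_fm_def
        bool_image_eq_iff[OF assms(1)] r_def ex_bool_eq disj_ac)
  also have "\<dots> \<longleftrightarrow> (\<exists>a \<in> domain A. \<exists>a' \<in> domain A.
       r a ` domain A = {False, True} \<and> r a' ` domain A = {False, True} \<and>
       (\<exists>b \<in> domain A. \<forall>c \<in> domain A. r c ` domain A = r b ` domain A \<longrightarrow> r a' c \<noteq> r a b))"
    using bool_image_cases[OF assms(1)] by (intro ex_value_and_type_iff) blast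
  finally show ?thesis .
qed

lemma sat_Phi:
  assumes "domain A \<noteq> {}"
  shows "sat A v (Phi R) \<longleftrightarrow> \<not> uniform (domain A) (\<lambda>x y. [x, y] \<in> rel A R)"
proof -
  define U where "U = domain A"
  define r where "r = (\<lambda>x y. [x, y] \<in> rel A R)"
  have Split: "sat A v (Split R) \<longleftrightarrow>
    (\<exists>a \<in> U. \<exists>b \<in> U. \<exists>c \<in> U. r b ` U = r c ` U \<and> \<not> r a b \<and> r a c)"
    using sat_Split[OF assms] unfolding U_def r_def .
  have Diverse: "sat A v (Diverse R) \<longleftrightarrow>
    (\<exists>a \<in> U. \<exists>a' \<in> U. r a ` U = {False, True} \<and> r a' ` U = {False, True} \<and>
       (\<exists>b \<in> U. \<forall>c \<in> U. r c ` U = r b ` U \<longrightarrow> r a' c \<noteq> r a b))"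
    using sat_Diverse[OF assms] unfolding U_def r_def .
  have "uniform U r" if "\<not> sat A v (Split R)" "\<not> sat A v (Diverse R)"
    unfolding uniform_def
  proof (intro ballI impI)
    fix b c a
    assume bc: "b \<in> U" "c \<in> U" and eq: "r b ` U = r c ` U" and a: "a \<in> U"
    have col: "r x y = r x z" if "x \<in> U" "y \<in> U" "z \<in> U" "r y ` U = r z ` U" for x y z
      using \<open>\<not> sat A v (Split R)\<close> that unfolding Split by metis
    have "r b a = r c a"
    proof (cases "r b ` U = {False, True}")
      case True
      \<comment> \<open>Failure of \<open>Diverse\<close> for the mixed rows of \<open>b\<close> and
        \<open>c\<close> only gives some \<open>d\<close> of the type of \<open>a\<close>; equality
        of columns, from failure of \<open>Split\<close>, moves the value from \<open>d\<close> to
        \<open>a\<close>.\<close>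
      then obtain d where "d \<in> U" "r d ` U = r a ` U" "r c d = r b a"
        using \<open>\<not> sat A v (Diverse R)\<close> bc a eq unfolding Diverse by metis
      then show ?thesis
        using col[of c d a] bc a by simp
    next
      case False
      show ?thesis
        using bool_image_constant[OF False eq a a] .
    qed
    then show "r a b = r a c \<and> r b a = r c a"
      using col bc a eq by blast
  qed
  moreover have "\<not> sat A v (Split R)" "\<not> sat A v (Diverse R)" if "uniform U r"
    using that unfolding Split Diverse uniform_def by metis+
  ultimately show ?thesis
    unfolding U_def r_def Phi_def by auto
qed

lemma models_Phi:
  assumes "domain A \<noteq> {}"
  shows "models A (Phi R) \<longleftrightarrow> \<not> uniform (domain A) (\<lambda>x y. [x, y] \<in> rel A R)"
proof -
  obtain a where "a \<in> domain A"
    using assms by auto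
  then have "range (\<lambda>_ :: nat. a) \<subseteq> domain A"
    by auto
  then show ?thesis
    unfolding models_def sat_Phi[OF assms] by blast
qed

section \<open>Preservation and syntax of \<open>Phi\<close>\<close>

lemma preserved_ext_Phi:
  fixes R :: 's
  shows "preserved_ext TYPE('a) (sig_R R) (Phi R)"
  unfolding preserved_ext_def
proof (intro allI impI)
  fix C D :: "('s, 'a) struct"
  assume C: "is_struct (sig_R R) C" and D: "is_struct (sig_R R) D"
    and CD: "substructure (sig_R R) C D" and "models C (Phi R)"
  have ne: "domain C \<noteq> {}" "domain D \<noteq> {}" and sub: "domain C \<subseteq> domain D"
    using C D CD by (auto simp: is_struct_def substructure_def)
  have "uniform (domain C) (\<lambda>x y. [x, y] \<in> rel C R) \<longleftrightarrow>
      uniform (domain C) (\<lambda>x y. [x, y] \<in> rel D R)"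
    using CD by (simp add: uniform_def substructure_def sig_R_def cong: image_cong_simp)
  then show "models D (Phi R)"
    using \<open>models C (Phi R)\<close> uniform_subset[OF _ sub ne(1)] models_Phi ne by metis
qed

lemma FL_Phi: "FL (sig_R R) 0 (Phi R)"
  unfolding Phi_def Split_def Diverse_def types_x2_def E_fm_def R_lit_def Z_fm_def O_fm_def M_fm_def
  \<comment> \<open>The quantifier and atom rules are instantiated at the levels that occur, so that
    their variable indices match the concrete numerals in \<open>Suc\<close> form.\<close>
  by (auto simp: numeral_eq_Suc suffix_vars_def sig_R_def
      intro!: FL.intros(4-6) FL_Exists[of _ 0, simplified] FL_Exists[of _ "Suc 0", simplified]
        FL_Exists[of _ "Suc (Suc 0)", simplified] FL_Forall[of _ "Suc (Suc 0)", simplified]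
        FL_Atom[of _ _ "Suc (Suc 0)" "Suc (Suc 0)", simplified suffix_vars_def, simplified]
        FL_Atom[of _ _ "Suc (Suc 0)" "Suc (Suc (Suc 0))", simplified suffix_vars_def, simplified])

lemma qrank_Phi: "qrank (Phi R) = 3"
  by (simp add: Phi_def Split_def Diverse_def types_x2_def E_fm_def R_lit_def
      Z_fm_def O_fm_def M_fm_def)

section \<open>Existential fluted formulas\<close>

text \<open>At level \<open>m\<close> the only atom is R(x_{m-1}, x_m), so \<open>S\<close> has to
  relate only the current elements and the earlier history may be forgotten. Without universal
  quantifiers the forth condition suffices; negated atoms require colours to agree in both
  directions.\<close>

lemma EFL_simulation:
  assumes "EFL (sig_R R) m \<psi>"
    and step: "\<And>a b a'. (a, b) \<in> S \<Longrightarrow> a' \<in> domain A \<Longrightarrow>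
      \<exists>b' \<in> domain B. (a', b') \<in> S \<and> ([a, a'] \<in> rel A R \<longleftrightarrow> [b, b'] \<in> rel B R)"
    and init: "\<And>a. a \<in> domain A \<Longrightarrow> \<exists>b \<in> domain B. (a, b) \<in> S"
    and "1 \<le> m \<Longrightarrow> (v m, w m) \<in> S"
    and "2 \<le> m \<Longrightarrow> [v (m - 1), v m] \<in> rel A R \<longleftrightarrow> [w (m - 1), w m] \<in> rel B R"
    and "sat A v \<psi>"
  shows "sat B w \<psi>"
  using assms(1,4-)
proof (induction arbitrary: v w)
  case (EFL_Atom T k m)
  then have "T = R" "k = 2" "suffix_vars m k = [m - 1, m]"
    by (auto simp: sig_R_def suffix_vars_def upt_rec split: if_splits)
  then show ?case
    using EFL_Atom by auto
next
  case (EFL_NegAtom T k m)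
  then have "T = R" "k = 2" "suffix_vars m k = [m - 1, m]"
    by (auto simp: sig_R_def suffix_vars_def upt_rec split: if_splits)
  then show ?case
    using EFL_NegAtom by auto
next
  case (EFL_Exists m \<phi>)
  then obtain a' where a': "a' \<in> domain A" "sat A (v(m + 1 := a')) \<phi>"
    by auto
  \<comment> \<open>At level 0 there is no previous element, hence no colour to match, and
    \<open>init\<close> takes the place of \<open>step\<close>.\<close>
  obtain b' where b': "b' \<in> domain B" "(a', b') \<in> S"
    "1 \<le> m \<Longrightarrow> [v m, a'] \<in> rel A R \<longleftrightarrow> [w m, b'] \<in> rel B R"
  proof (cases "1 \<le> m")
    case True
    then show ?thesis
      using step[OF EFL_Exists.prems(1) a'(1)] that by blast
  next
    case False
    then show ?thesis
      using init[OF a'(1)] that by blast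
  qed
  have "sat B (w(m + 1 := b')) \<phi>"
    by (rule EFL_Exists.IH[OF _ _ a'(2)]) (use b' in auto)
  then show ?case
    using b' by auto
qed auto

lemma not_equivalent_Phi:
  fixes R :: 's
  assumes "infinite (UNIV :: 'b set)" and "EFL (sig_R R) 0 \<psi>"
  shows "\<not> equivalent TYPE('b) (sig_R R) (Phi R) \<psi>"
proof
  assume eq: "equivalent TYPE('b) (sig_R R) (Phi R) \<psi>"
  obtain X :: "'b set" where "card X = 3"
    using infinite_arbitrarily_large[OF assms(1)] by blast
  then obtain m p q :: 'b where dist: "m \<noteq> p" "m \<noteq> q" "p \<noteq> q"
    by (auto simp: card_3_iff)
  define A :: "('s, 'b) struct" where "A =
    \<lparr>domain = {m, p, q}, rel = \<lambda>_. {as. length as = 2 \<and> set as \<subseteq> {m, p, q} \<and> as \<noteq> [m, p]}\<rparr>"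
  define B :: "('s, 'b) struct" where "B =
    \<lparr>domain = {m, p}, rel = \<lambda>_. {as. length as = 2 \<and> set as \<subseteq> {m, p} \<and> as \<noteq> [m, p]}\<rparr>"
  \<comment> \<open>Any edge of \<open>A\<close> is matched by a move to \<open>m\<close>, which
    receives edges from both elements of \<open>B\<close>. The only non-edge of \<open>A\<close>
    starts at \<open>m\<close>, which is matched by \<open>m\<close> alone, and ends at
    \<open>p\<close>, which may be matched by \<open>p\<close>.\<close>
  define S where "S = {m, p, q} \<times> {m} \<union> {p, q} \<times> {p}"
  have A: "is_struct (sig_R R) A" and B: "is_struct (sig_R R) B"
    by (auto simp: is_struct_def sig_R_def A_def B_def)
  have "models A (Phi R)"
  proof -
    \<comment> \<open>\<open>p\<close> and \<open>q\<close> both have edges to everything, but only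
      \<open>q\<close> has an edge from \<open>m\<close>.\<close>
    have "\<not> uniform (domain A) (\<lambda>x y. [x, y] \<in> rel A R)"
      using dist by (auto simp: uniform_def A_def)
    then show ?thesis
      by (subst models_Phi) (auto simp: A_def)
  qed
  then have "models A \<psi>"
    using eq A by (simp add: equivalent_def)
  then have "sat A (\<lambda>_. m) \<psi>"
    by (auto simp: models_def A_def)
  have "sat B w \<psi>" for w
  proof (rule EFL_simulation[OF assms(2), where S = S and v = "\<lambda>_. m"])
    fix a b a'
    assume "(a, b) \<in> S" "a' \<in> domain A"
    then show "\<exists>b' \<in> domain B. (a', b') \<in> S \<and> ([a, a'] \<in> rel A R \<longleftrightarrow> [b, b'] \<in> rel B R)"
      using dist by (auto simp: S_def A_def B_def)
  qed (use \<open>sat A (\<lambda>_. m) \<psi>\<close> in \<open>auto simp: S_def A_def B_def\<close>)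
  then have "models B (Phi R)"
    using eq B by (simp add: equivalent_def models_def)
  \<comment> \<open>\<open>m\<close> is mixed and \<open>p\<close> is full, so no two distinct
    elements share a type.\<close>
  moreover have "uniform (domain B) (\<lambda>x y. [x, y] \<in> rel B R)"
    using dist by (auto simp: uniform_def B_def)
  ultimately show False
    using models_Phi[of B R] by (simp add: B_def)
qed

theorem theorem4p8:
  fixes R :: 's
  assumes "infinite (UNIV :: 'b set)"
  shows "FL (sig_R R) 0 (Phi R)
    \<and> qrank (Phi R) = 3
    \<and> preserved_ext TYPE('a) (sig_R R) (Phi R)
    \<and> \<not> (\<exists>\<psi>. EFL (sig_R R) 0 \<psi> \<and> equivalent TYPE('b) (sig_R R) (Phi R) \<psi>)
    \<and> \<not> fluted_Los_Tarski TYPE('b) (sig_R R)"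
  using FL_Phi[of R] qrank_Phi[of R] preserved_ext_Phi[where R = R and ?'a = 'a]
    preserved_ext_Phi[where R = R and ?'a = 'b] not_equivalent_Phi[OF assms, of R]
  unfolding fluted_Los_Tarski_def by blast

end
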